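(* Consider Misère Connect $k$ on a board with odd height $h\ge 3$ and even width $w\ge k\ge 3$. If P2 plays the delayed take-even strategy, then, whatever P1 does, P2 always has a move prescribed by the strategy available, and P1 is eventually forced to connect $k$ (before P2 does). In particular, P2 has a guaranteed win.
   Context: Misère Connect $k$ is played on a grid with $w$ columns and $h$ rows ($w,h$ positive integers). Player 1 (P1, pieces X) and Player 2 (P2, pieces O) alternate turns, P1 first. On each turn the player selects a non-full column and their piece occupies the lowest empty cell of that column; a column is full after $h$ plays. A player connects $k$ when $k$ of their pieces occupy $k$ consecutive cells in a horizontal, vertical, or diagonal (either direction) line. The first player to connect $k$ loses (the other wins) and the game ends. If the board fills with no player having connected $k$, the game is a draw. Here rows are numbered $0,1,\dots,h-1$ from the bottom. The delayed take-even strategy for a player is: (1) if the opponent plays in row $0$, follow with a non-losing move in row $0$; (2) if the opponent plays in any other row, play directly on top of the opponent's piece. The "non-losing" moves in row $0$ are those made according to a fixed strategy for the one-row game (height $1$, same width $w$, the same player moving second, respectively first) that guarantees that this player never has $k$ consecutive pieces in row $0$. *)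

theory Defs
  imports Main
begin

text \<open>
  A column is the list of its pieces from bottom to top, so \<open>b c ! r\<close> is the piece in
  column \<open>c\<close>, row \<open>r\<close>, and gravity is built in.  Columns are \<open>0, \<dots>, w - 1\<close> and
  rows \<open>0, \<dots>, h - 1\<close>.
\<close>

datatype player = P1 | P2

fun opponent :: "player \<Rightarrow> player" where
  "opponent P1 = P2"
| "opponent P2 = P1"

type_synonym board = "nat \<Rightarrow> player list"

definition occupies :: "board \<Rightarrow> player \<Rightarrow> nat \<Rightarrow> nat \<Rightarrow> bool" where
  "occupies b p c r \<longleftrightarrow> r < length (b c) \<and> b c ! r = p"

text \<open>
  In the last disjunct (falling diagonals), \<open>(c, r)\<close> is the lower left corner of the square
  spanned by the line, which avoids subtraction below row 0.
\<close>

definition connects :: "nat \<Rightarrow> board \<Rightarrow> player \<Rightarrow> bool" where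
  "connects k b p \<longleftrightarrow>
     (\<exists>c r. \<forall>i<k. occupies b p (c + i) r) \<or>
     (\<exists>c r. \<forall>i<k. occupies b p c (r + i)) \<or>
     (\<exists>c r. \<forall>i<k. occupies b p (c + i) (r + i)) \<or>
     (\<exists>c r. \<forall>i<k. occupies b p (c + i) (r + (k - 1 - i)))"

text \<open>
  A history lists the columns played so far by both players, with the most recent move first:
  in \<open>c # ms\<close>, the move \<open>c\<close> was made after the history \<open>ms\<close>.
\<close>

type_synonym history = "nat list"

definition mover :: "history \<Rightarrow> player" where
  "mover ms = (if even (length ms) then P1 else P2)"

fun board_of :: "history \<Rightarrow> board" where
  "board_of [] = (\<lambda>_. [])"
| "board_of (c # ms) = (board_of ms)(c := board_of ms c @ [mover ms])"

definition landing_row :: "history \<Rightarrow> nat \<Rightarrow> nat" where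
  "landing_row ms c = length (board_of ms c)"

definition legal_move :: "nat \<Rightarrow> nat \<Rightarrow> history \<Rightarrow> nat \<Rightarrow> bool" where
  "legal_move w h ms c \<longleftrightarrow> c < w \<and> landing_row ms c < h"

definition board_full :: "nat \<Rightarrow> nat \<Rightarrow> history \<Rightarrow> bool" where
  "board_full w h ms \<longleftrightarrow> (\<forall>c<w. length (board_of ms c) = h)"

definition game_over :: "nat \<Rightarrow> nat \<Rightarrow> nat \<Rightarrow> history \<Rightarrow> bool" where
  "game_over w h k ms \<longleftrightarrow>
     connects k (board_of ms) P1 \<or> connects k (board_of ms) P2 \<or> board_full w h ms"

inductive play :: "nat \<Rightarrow> nat \<Rightarrow> nat \<Rightarrow> history \<Rightarrow> bool" for w h k :: nat where
  start: "play w h k []"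
| move: "play w h k ms \<Longrightarrow> \<not> game_over w h k ms \<Longrightarrow> legal_move w h ms c \<Longrightarrow> play w h k (c # ms)"

text \<open>
  A play stops as soon as some player connects \<open>k\<close>, so in a play \<open>wins k p ms\<close> means that the
  opponent of \<open>p\<close> was the first to do so.
\<close>

definition wins :: "nat \<Rightarrow> player \<Rightarrow> history \<Rightarrow> bool" where
  "wins k p ms \<longleftrightarrow> connects k (board_of ms) (opponent p) \<and> \<not> connects k (board_of ms) p"

type_synonym strategy = "history \<Rightarrow> nat"

fun follows :: "player \<Rightarrow> strategy \<Rightarrow> history \<Rightarrow> bool" where
  "follows p \<sigma> [] \<longleftrightarrow> True"
| "follows p \<sigma> (c # ms) \<longleftrightarrow> follows p \<sigma> ms \<and> (mover ms = p \<longrightarrow> c = \<sigma> ms)"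

definition legal_strategy :: "nat \<Rightarrow> nat \<Rightarrow> nat \<Rightarrow> player \<Rightarrow> strategy \<Rightarrow> bool" where
  "legal_strategy w h k p \<sigma> \<longleftrightarrow>
     (\<forall>ms. play w h k ms \<and> follows p \<sigma> ms \<and> \<not> game_over w h k ms \<and> mover ms = p
        \<longrightarrow> legal_move w h ms (\<sigma> ms))"

definition winning_strategy :: "nat \<Rightarrow> nat \<Rightarrow> nat \<Rightarrow> player \<Rightarrow> strategy \<Rightarrow> bool" where
  "winning_strategy w h k p \<sigma> \<longleftrightarrow>
     legal_strategy w h k p \<sigma> \<and>
     (\<forall>\<rho>. legal_strategy w h k (opponent p) \<rho> \<longrightarrow>
        (\<exists>ms. play w h k ms \<and> follows p \<sigma> ms \<and> follows (opponent p) \<rho> ms \<and> wins k p ms))"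

definition nonlosing_row_strategy :: "nat \<Rightarrow> nat \<Rightarrow> player \<Rightarrow> strategy \<Rightarrow> bool" where
  "nonlosing_row_strategy w k p \<sigma> \<longleftrightarrow>
     legal_strategy w 1 k p \<sigma> \<and>
     (\<forall>ms. play w 1 k ms \<and> follows p \<sigma> ms \<longrightarrow> \<not> connects k (board_of ms) p)"

fun row0_moves :: "history \<Rightarrow> history" where
  "row0_moves [] = []"
| "row0_moves (c # ms) = (if landing_row ms c = 0 then c # row0_moves ms else row0_moves ms)"

text \<open>
  The parameter \<open>\<sigma>\<close> is the strategy for the one-row game; it sees only the moves made in row 0.
  The first equation is the opening move of a player who moves first.  That the move chosen by
  \<open>\<sigma>\<close> in the second equation really lands in row 0 is not part of the definition and has to be
  shown.
\<close>

fun delayed_take_even :: "strategy \<Rightarrow> strategy" where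
  "delayed_take_even \<sigma> [] = \<sigma> []"
| "delayed_take_even \<sigma> (d # ms) =
     (if landing_row ms d = 0 then \<sigma> (row0_moves (d # ms)) else d)"

end

theory Submission
  imports Defs
begin

text \<open>
  Split the cells above row 0 of each column into the pairs of rows \<open>(1, 2), (3, 4), \<dots>\<close>.  As
  \<open>h\<close> is odd, these pairs exhaust the column, so an answer directly on top of the opponent's
  piece is always possible; as \<open>w\<close> is even, an answer in row 0 is possible as well.
  After each full round every column is therefore empty or of odd height, and above row 0 the odd
  rows belong to P1 and the even rows to P2 (\<open>invariant_holds\<close>).  Meanwhile the moves in row 0
  form a play of the one-row game in which P2 follows the given non-losing strategy.

  P2 never connects first.  A vertical or diagonal line meets an odd row, where P2 has no pieces,
  so a connection of P2 is horizontal and lies in an even row.  It cannot lie in row 0, by the choice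
  of the one-row strategy.  If it lies higher up, then the cells directly below it belong to P1 and
  were all filled before P2's last move, so P1 had already lost (\<open>P2_never_connects\<close>).
  On the other hand, a full board has P1 all along row 1, so a draw is impossible.  The game is
  finite, and hence P1 connects.

  A non-losing strategy for the one-row game exists: pair the columns \<open>2 * i\<close> and
  \<open>2 * i + 1\<close> and always answer in the other column of the pair.  Three consecutive columns
  contain a whole pair, and P2 owns only one cell of it.
\<close>

section \<open>Boards and plays\<close>

lemma mover_Cons [simp]: "mover (c # ms) = opponent (mover ms)"
  by (simp add: mover_def)

lemma mover_eq_P1 [simp]: "mover ms = P1 \<longleftrightarrow> even (length ms)"
  by (simp add: mover_def)

lemma mover_eq_P2 [simp]: "mover ms = P2 \<longleftrightarrow> odd (length ms)"
  by (simp add: mover_def)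

lemma opponent_eq_iff [simp]: "opponent p = P1 \<longleftrightarrow> p = P2" "opponent p = P2 \<longleftrightarrow> p = P1"
  by (cases p; simp)+

lemma opponent_opponent [simp]: "opponent (opponent p) = p"
  by (cases p) simp_all

lemma occupies_board_of_Cons:
  "occupies (board_of (c # ms)) p x r \<longleftrightarrow>
     occupies (board_of ms) p x r \<or> (x = c \<and> r = landing_row ms c \<and> p = mover ms)"
  by (auto simp: occupies_def landing_row_def nth_append)

lemma connects_mono:
  assumes "connects k b p" and "\<And>c r. occupies b p c r \<Longrightarrow> occupies b' p c r"
  shows "connects k b' p"
  using assms unfolding connects_def by meson

lemma connects_by_opponent_move:
  assumes "connects k (board_of (c # ms)) p" and "mover ms \<noteq> p"
  shows "connects k (board_of ms) p"
  using assms(1) by (rule connects_mono) (use assms(2) in \<open>auto simp: occupies_board_of_Cons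
      simp del: board_of.simps\<close>)

lemma play_ConsD:
  assumes "play w h k (c # ms)"
  shows "play w h k ms" "\<not> game_over w h k ms" "legal_move w h ms c"
  using assms by (auto elim: play.cases)

lemma play_column_height: "play w h k ms \<Longrightarrow> length (board_of ms c) \<le> h"
  by (induction rule: play.induct) (auto simp: legal_move_def landing_row_def)

lemma play_length: "play w h k ms \<Longrightarrow> length ms = (\<Sum>c<w. length (board_of ms c))"
proof (induction rule: play.induct)
  case start
  show ?case by simp
next
  case (move ms c)
  have "(\<Sum>x<w. length (board_of (c # ms) x)) =
        (\<Sum>x<w. length (board_of ms x) + (if x = c then 1 else 0))"
    by (intro sum.cong) auto
  also have "\<dots> = length ms + 1"
    using move by (simp add: sum.distrib legal_move_def)
  finally show ?case by simp
qed

lemma play_length_le: "play w h k ms \<Longrightarrow> length ms \<le> w * h"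
  using sum_bounded_above[of "{..<w}" "\<lambda>c. length (board_of ms c)" h]
  by (simp add: play_length play_column_height)

lemma play_length_full: "play w h k ms \<Longrightarrow> board_full w h ms \<Longrightarrow> length ms = w * h"
  by (simp add: play_length board_full_def)

text \<open>
  The invariants of a P2 strategy hold only when P1 is to move, so the natural induction adds a
  whole round at a time.
\<close>

lemma round_induct [consumes 3, case_names start round]:
  assumes "play w h k ms" and "follows P2 \<tau> ms" and "even (length ms)"
    and start: "Q []"
    and round: "\<And>d ms. \<lbrakk>play w h k (\<tau> (d # ms) # d # ms); follows P2 \<tau> ms; even (length ms); Q ms\<rbrakk>
      \<Longrightarrow> Q (\<tau> (d # ms) # d # ms)"
  shows "Q ms"
  using assms(1-3)
proof (induction ms rule: induct_list012)
  case 1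
  then show ?case using start by simp
next
  case (2 c)
  then show ?case by simp
next
  case (3 c d ms)
  have "play w h k (d # ms)" "follows P2 \<tau> ms" "c = \<tau> (d # ms)"
    using 3(3-5) by (auto dest: play_ConsD)
  moreover have "Q ms"
    using 3(5) \<open>follows P2 \<tau> ms\<close> play_ConsD(1)[OF \<open>play w h k (d # ms)\<close>] by (intro 3(1)) auto
  ultimately show ?case
    using 3(3,5) round[of d ms] by simp
qed

text \<open>
  Since plays have bounded length, two legal strategies can be played against each other until the
  game ends.  So it suffices to look at the final positions.
\<close>

lemma winning_strategyI:
  assumes legal: "legal_strategy w h k p \<sigma>"
    and ends: "\<And>ms. play w h k ms \<Longrightarrow> follows p \<sigma> ms \<Longrightarrow> game_over w h k ms \<Longrightarrow> wins k p ms"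
  shows "winning_strategy w h k p \<sigma>"
  unfolding winning_strategy_def
proof (intro conjI allI impI legal)
  fix \<rho> assume legal': "legal_strategy w h k (opponent p) \<rho>"
  define A where "A ms \<longleftrightarrow> play w h k ms \<and> follows p \<sigma> ms \<and> follows (opponent p) \<rho> ms" for ms
  have "A []" by (simp add: A_def play.start)
  moreover have "\<forall>ms. A ms \<longrightarrow> length ms < Suc (w * h)"
    by (auto simp: A_def less_Suc_eq_le play_length_le)
  ultimately obtain ms where ms: "A ms" and maximal: "\<And>ms'. A ms' \<Longrightarrow> length ms' \<le> length ms"
    using ex_has_greatest_nat[of A "[]" length] by blast
  have "game_over w h k ms"
  proof (rule ccontr)
    assume running: "\<not> game_over w h k ms"
    let ?c = "if mover ms = p then \<sigma> ms else \<rho> ms"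
    have "mover ms = p \<or> mover ms = opponent p"
      by (cases "mover ms"; cases p) auto
    moreover have "opponent p \<noteq> p" by (cases p) auto
    ultimately have "A (?c # ms)"
      using ms running legal legal' unfolding A_def legal_strategy_def
      by (auto intro!: play.move)
    from maximal[OF this] show False by simp
  qed
  then show "\<exists>ms. play w h k ms \<and> follows p \<sigma> ms \<and> follows (opponent p) \<rho> ms \<and> wins k p ms"
    using ms ends by (auto simp: A_def)
qed

section \<open>A non-losing strategy for the one-row game\<close>

definition partner :: "nat \<Rightarrow> nat" where
  "partner c = (if even c then c + 1 else c - 1)"

definition pairing_strategy :: strategy where
  "pairing_strategy ms = partner (hd ms)"

lemma partner_partner [simp]: "partner (partner c) = c"
  by (auto simp: partner_def elim: oddE)

lemma partner_neq [simp]: "partner c \<noteq> c"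
  by (auto simp: partner_def elim: oddE)

lemma partner_less: "even w \<Longrightarrow> c < w \<Longrightarrow> partner c < w"
  by (auto simp: partner_def elim!: evenE)

text \<open>
  This form of the invariant says at once that the columns of a pair have equal height and that
  P2 never owns both cells of a pair; it does not depend on the height of the board.
\<close>

lemma pairing_invariant:
  assumes "play w h k ms" and "follows P2 pairing_strategy ms" and "even (length ms)"
  shows "board_of ms (partner c) = map opponent (board_of ms c)"
  using assms
proof (induction arbitrary: c rule: round_induct)
  case start
  show ?case by simp
next
  case (round d ms)
  have "mover ms = P1" using round by simp
  moreover have "partner c = d \<longleftrightarrow> c = partner d" and "partner c = partner d \<longleftrightarrow> c = d"
    by (metis partner_partner)+
  ultimately show ?case
    using round(4)[of c] partner_neq[of d] partner_neq[of d, symmetric]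
    by (auto simp: pairing_strategy_def)
qed

lemma pairing_strategy_nonlosing:
  assumes "even w" and "k \<ge> 3"
  shows "nonlosing_row_strategy w k P2 pairing_strategy"
  unfolding nonlosing_row_strategy_def legal_strategy_def
proof (intro conjI allI impI; elim conjE)
  fix ms
  assume ms: "play w 1 k ms" "follows P2 pairing_strategy ms" "mover ms = P2"
  then obtain d ms' where [simp]: "ms = d # ms'" by (cases ms) auto
  have "legal_move w 1 ms' d" "play w 1 k ms'"
    using ms play_ConsD by auto
  moreover have "board_of ms' (partner d) = map opponent (board_of ms' d)"
    using ms play_ConsD by (intro pairing_invariant) auto
  ultimately show "legal_move w 1 ms (pairing_strategy ms)"
    using assms(1) by (auto simp: legal_move_def landing_row_def pairing_strategy_def partner_less)
next
  have even_case: "\<not> connects k (board_of ms) P2"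
    if ms: "play w 1 k ms" "follows P2 pairing_strategy ms" "even (length ms)" for ms
  proof
    have row: "r = 0" if "occupies (board_of ms) P2 c r" for c r
      using that play_column_height[OF ms(1), of c] by (simp add: occupies_def)
    have not_both: "\<not> occupies (board_of ms) P2 (partner c) 0" if "occupies (board_of ms) P2 c 0" for c
      using that pairing_invariant[OF ms, of c] by (auto simp: occupies_def)
    assume "connects k (board_of ms) P2"
    then show False unfolding connects_def
    proof (elim disjE exE)
      fix c r assume *: "\<forall>i<k. occupies (board_of ms) P2 (c + i) r"
      have three: "occupies (board_of ms) P2 (c + i) 0" if "i < 3" for i
        using * row[of "c + i" r] that assms(2) by auto
      show False
      proof (cases "even c")
        case True
        then show False
          using three[of 0] three[of 1] not_both[of c] by (simp add: partner_def)
      next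
        case False
        then show False
          using three[of 1] three[of 2] not_both[of "c + 1"] by (simp add: partner_def)
      qed
    next
      fix c r assume *: "\<forall>i<k. occupies (board_of ms) P2 c (r + i)"
      show False using *[rule_format, of 1] row assms(2) by fastforce
    next
      fix c r assume *: "\<forall>i<k. occupies (board_of ms) P2 (c + i) (r + i)"
      show False using *[rule_format, of 1] row assms(2) by fastforce
    next
      fix c r assume *: "\<forall>i<k. occupies (board_of ms) P2 (c + i) (r + (k - 1 - i))"
      show False using *[rule_format, of 0] row assms(2) by fastforce
    qed
  qed
  fix ms
  assume ms: "play w 1 k ms" "follows P2 pairing_strategy ms"
  show "\<not> connects k (board_of ms) P2"
  proof (cases "even (length ms)")
    case True
    then show ?thesis using ms even_case by blast
  next
    case False
    then obtain d ms' where [simp]: "ms = d # ms'" by (cases ms) auto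
    have "\<not> connects k (board_of ms') P2"
      using ms False play_ConsD by (intro even_case) auto
    then show ?thesis
      using False connects_by_opponent_move[of k d ms' P2] by auto
  qed
qed

section \<open>The state of the board after each round\<close>

definition settled :: "board \<Rightarrow> bool" where
  "settled b \<longleftrightarrow>
     (\<forall>c. b c = [] \<or> odd (length (b c))) \<and>
     (\<forall>c r p. occupies b p c r \<and> r > 0 \<longrightarrow> p = (if odd r then P1 else P2))"

lemma settledD:
  assumes "settled b"
  shows "b c = [] \<or> odd (length (b c))"
    and "occupies b p c r \<Longrightarrow> r > 0 \<Longrightarrow> p = (if odd r then P1 else P2)"
  using assms unfolding settled_def by blast+

text \<open>
  The relation between a position and the position of the one-row game that its moves in row 0
  produce.  The length condition makes the same player move in both games.
\<close>

definition row0_synced :: "history \<Rightarrow> bool" where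
  "row0_synced ms \<longleftrightarrow>
     even (length (row0_moves ms)) = even (length ms) \<and>
     (\<forall>c. board_of (row0_moves ms) c = take 1 (board_of ms c))"

lemma row0_synced_mover: "row0_synced ms \<Longrightarrow> mover (row0_moves ms) = mover ms"
  by (simp add: row0_synced_def mover_def)

lemma row0_synced_Cons:
  assumes "row0_synced ms" and "landing_row ms c = 0"
  shows "row0_synced (c # ms)"
  using assms row0_synced_mover[OF assms(1)]
  by (auto simp: row0_synced_def landing_row_def)

lemma row0_synced_connects:
  assumes "row0_synced ms" and "connects k (board_of (row0_moves ms)) p"
  shows "connects k (board_of ms) p"
  using assms(2) by (rule connects_mono) (use assms(1) in \<open>auto simp: row0_synced_def occupies_def\<close>)

definition invariant :: "nat \<Rightarrow> nat \<Rightarrow> strategy \<Rightarrow> history \<Rightarrow> bool" where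
  "invariant w k \<sigma> ms \<longleftrightarrow>
     settled (board_of ms) \<and> row0_synced ms \<and>
     play w 1 k (row0_moves ms) \<and> follows P2 \<sigma> (row0_moves ms)"

text \<open>
  The one-row game is still running whenever \<open>\<sigma>\<close> has to answer: its connections would also be
  connections on the whole board, and a full row would contain \<open>w\<close> pieces, an even number, while
  P2 answers after an odd number of moves.
\<close>

lemma row0_answer:
  assumes "even w" and \<sigma>: "nonlosing_row_strategy w k P2 \<sigma>"
    and inv: "invariant w k \<sigma> ms" and "even (length ms)"
    and play: "play w h k (d # ms)" and running: "\<not> game_over w h k (d # ms)"
    and row0: "landing_row ms d = 0"
  defines "c \<equiv> \<sigma> (d # row0_moves ms)"
  shows "legal_move w h (d # ms) c" and "landing_row (d # ms) c = 0"
    and "play w 1 k (c # d # row0_moves ms)" and "follows P2 \<sigma> (c # d # row0_moves ms)"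
proof -
  let ?R = "row0_moves ms"
  have sync: "row0_synced ms" and Rplay: "play w 1 k ?R" and Rfollows: "follows P2 \<sigma> ?R"
    using inv by (auto simp: invariant_def)
  have sync': "row0_synced (d # ms)"
    using sync row0 by (rule row0_synced_Cons)
  have [simp]: "even (length ?R)"
    using sync \<open>even (length ms)\<close> by (simp add: row0_synced_def)
  have d: "legal_move w h ms d" and "\<not> game_over w h k ms"
    using play_ConsD[OF play] by auto
  have legal_d: "legal_move w 1 ?R d"
    using d sync row0 by (simp add: legal_move_def landing_row_def row0_synced_def)
  have "\<not> board_full w 1 ?R"
    using legal_d by (auto simp: board_full_def legal_move_def landing_row_def)
  then have "\<not> game_over w 1 k ?R"
    using \<open>\<not> game_over w h k ms\<close> row0_synced_connects[OF sync] by (auto simp: game_over_def)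
  then have Rplay': "play w 1 k (d # ?R)"
    using Rplay legal_d by (intro play.move)
  have "\<not> board_full w 1 (d # ?R)"
    using play_length_full[OF Rplay'] \<open>even w\<close> by fastforce
  then have Rrunning: "\<not> game_over w 1 k (d # ?R)"
    using running row0_synced_connects[OF sync'] row0 by (auto simp: game_over_def)
  have "legal_move w 1 (d # ?R) c"
    using \<sigma> Rplay' Rrunning Rfollows
    unfolding nonlosing_row_strategy_def legal_strategy_def c_def by auto
  then show "play w 1 k (c # d # ?R)"
    using Rplay' Rrunning by (blast intro: play.move)
  show "follows P2 \<sigma> (c # d # ?R)"
    using Rfollows by (simp add: c_def)
  have "c < w" and "board_of (d # ?R) c = []"
    using \<open>legal_move w 1 (d # ?R) c\<close> by (auto simp: legal_move_def landing_row_def)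
  moreover have "board_of (d # ?R) c = take 1 (board_of (d # ms) c)"
    using sync' row0 by (simp add: row0_synced_def del: board_of.simps)
  ultimately show "landing_row (d # ms) c = 0"
    by (simp add: landing_row_def del: board_of.simps)
  then show "legal_move w h (d # ms) c"
    using \<open>c < w\<close> d row0 by (simp add: legal_move_def)
qed

text \<open>
  Columns that are not empty have odd height after each round, so P1 moves to an odd row of such a
  column; as \<open>h\<close> is odd, the row above it exists.
\<close>

lemma answer_on_top:
  assumes "odd h" and "settled (board_of ms)" and "legal_move w h ms d" and "landing_row ms d > 0"
  shows "odd (landing_row ms d)" and "legal_move w h (d # ms) d"
proof -
  show "odd (landing_row ms d)"
    using settledD(1)[OF assms(2), of d] assms(4) by (auto simp: landing_row_def)
  moreover have "landing_row ms d < h"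
    using assms(3) by (simp add: legal_move_def)
  ultimately have "Suc (landing_row ms d) < h"
    using \<open>odd h\<close> by (metis Suc_lessI even_Suc)
  then show "legal_move w h (d # ms) d"
    using assms(3) by (simp add: legal_move_def landing_row_def)
qed

lemma settled_row0_round:
  assumes "settled (board_of ms)" and "landing_row ms d = 0" and "landing_row (d # ms) c = 0"
  shows "settled (board_of (c # d # ms))"
proof -
  have "board_of ms d = []" and "board_of ms c = []" and "c \<noteq> d"
    using assms(2,3) by (auto simp: landing_row_def split: if_splits)
  then show ?thesis
    using assms settledD[OF assms(1)]
    unfolding settled_def occupies_board_of_Cons by (auto split: if_splits)
qed

lemma settled_stacked_round:
  assumes "settled (board_of ms)" and "even (length ms)" and "odd (landing_row ms d)"
  shows "settled (board_of (d # d # ms))"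
proof -
  have "mover ms = P1" and "landing_row (d # ms) d = Suc (landing_row ms d)"
    using assms(2) by (simp_all add: landing_row_def)
  then have "p = (if odd r then P1 else P2)"
    if "occupies (board_of (d # d # ms)) p x r" and "r > 0" for x r p
    using that settledD(2)[OF assms(1), of p x r] assms(3)
    unfolding occupies_board_of_Cons by (elim disjE) simp_all
  moreover have "board_of (d # d # ms) x = [] \<or> odd (length (board_of (d # d # ms) x))" for x
    using settledD(1)[OF assms(1), of x] assms(3) by (auto simp: landing_row_def)
  ultimately show ?thesis unfolding settled_def by blast
qed

lemma invariant_holds:
  assumes "odd h" and "even w" and \<sigma>: "nonlosing_row_strategy w k P2 \<sigma>"
    and "play w h k ms" and "follows P2 (delayed_take_even \<sigma>) ms" and "even (length ms)"
  shows "invariant w k \<sigma> ms"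
  using assms(4-6)
proof (induction rule: round_induct)
  case start
  show ?case
    by (auto simp: invariant_def settled_def row0_synced_def occupies_def play.start)
next
  case (round d ms)
  let ?c = "delayed_take_even \<sigma> (d # ms)"
  have play: "play w h k (d # ms)" and running: "\<not> game_over w h k (d # ms)"
    using play_ConsD[OF round(1)] by auto
  have settled: "settled (board_of ms)" and sync: "row0_synced ms"
    using round.IH by (auto simp: invariant_def)
  show ?case
  proof (cases "landing_row ms d = 0")
    case True
    then have c: "?c = \<sigma> (d # row0_moves ms)" by simp
    note answer = row0_answer[OF \<open>even w\<close> \<sigma> round.IH \<open>even (length ms)\<close> play running True,
        folded c]
    have "row0_moves (?c # d # ms) = ?c # d # row0_moves ms"
      using True answer(2) by (simp only: row0_moves.simps refl if_True)
    moreover have "row0_synced (?c # d # ms)"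
      using sync True answer(2) by (intro row0_synced_Cons)
    moreover have "settled (board_of (?c # d # ms))"
      using settled True answer(2) by (rule settled_row0_round)
    ultimately show ?thesis
      using answer(3,4) by (simp only: invariant_def)
  next
    case False
    then have c: "?c = d" by simp
    have "settled (board_of (d # d # ms))"
      using settled \<open>even (length ms)\<close> answer_on_top(1)[OF \<open>odd h\<close> settled] False play_ConsD(3)[OF play]
      by (intro settled_stacked_round) auto
    moreover have rows: "row0_moves (d # d # ms) = row0_moves ms"
      using False by (simp add: landing_row_def)
    moreover have "row0_synced (d # d # ms)"
      unfolding row0_synced_def rows
      using sync False by (auto simp: row0_synced_def landing_row_def Suc_le_eq)
    ultimately show ?thesis
      using round.IH unfolding c by (simp add: invariant_def del: board_of.simps row0_moves.simps)
  qed
qed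

lemma delayed_take_even_answer:
  assumes "odd h" and "even w" and \<sigma>: "nonlosing_row_strategy w k P2 \<sigma>"
    and play: "play w h k (d # ms)" and "follows P2 (delayed_take_even \<sigma>) (d # ms)"
    and running: "\<not> game_over w h k (d # ms)" and "mover (d # ms) = P2"
  defines "c \<equiv> delayed_take_even \<sigma> (d # ms)"
  shows "legal_move w h (d # ms) c"
    and "if landing_row ms d = 0 then landing_row (d # ms) c = 0
         else c = d \<and> landing_row (d # ms) c = landing_row ms d + 1"
proof -
  have evn: "even (length ms)" using assms(7) by simp
  have inv: "invariant w k \<sigma> ms"
    using assms(1-3,5) play_ConsD(1)[OF play] evn by (intro invariant_holds) auto
  have "legal_move w h (d # ms) c \<and>
    (if landing_row ms d = 0 then landing_row (d # ms) c = 0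
     else c = d \<and> landing_row (d # ms) c = landing_row ms d + 1)"
  proof (cases "landing_row ms d = 0")
    case True
    then show ?thesis
      using row0_answer(1,2)[OF \<open>even w\<close> \<sigma> inv evn play running True]
      by (simp add: c_def)
  next
    case False
    then have "c = d" by (simp add: c_def)
    moreover have "settled (board_of ms)" using inv by (simp add: invariant_def)
    ultimately show ?thesis
      using answer_on_top(2)[OF \<open>odd h\<close> _ play_ConsD(3)[OF play]] False
      by (simp add: landing_row_def)
  qed
  then show "legal_move w h (d # ms) c"
    and "if landing_row ms d = 0 then landing_row (d # ms) c = 0
         else c = d \<and> landing_row (d # ms) c = landing_row ms d + 1"
    by auto
qed

section \<open>Only P1 connects\<close>

text \<open>
  Every vertical or diagonal line has cells in two adjacent rows, and P2 has no pieces in the odd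
  one of them.
\<close>

lemma settled_connects_P2:
  assumes "settled b" and "connects k b P2" and "k \<ge> 2"
  obtains c r where "even r" and "\<forall>i<k. occupies b P2 (c + i) r"
proof -
  have evn: "even r" if "occupies b P2 c r" for c r
    using settledD(2)[OF assms(1) that] odd_pos[of r] by (cases "odd r") auto
  from assms(2) show thesis unfolding connects_def
  proof (elim disjE exE)
    fix c r assume *: "\<forall>i<k. occupies b P2 (c + i) r"
    then have "occupies b P2 (c + 0) r" using assms(3) by fastforce
    then show thesis using * evn that by blast
  next
    fix c r assume *: "\<forall>i<k. occupies b P2 c (r + i)"
    have "even (r + 0)" and "even (r + 1)"
      using *[rule_format, THEN evn, of 0] *[rule_format, THEN evn, of 1] assms(3) by auto
    then show thesis by simp
  next
    fix c r assume *: "\<forall>i<k. occupies b P2 (c + i) (r + i)"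
    have "even (r + 0)" and "even (r + 1)"
      using *[rule_format, THEN evn, of 0] *[rule_format, THEN evn, of 1] assms(3) by auto
    then show thesis by simp
  next
    fix c r assume *: "\<forall>i<k. occupies b P2 (c + i) (r + (k - 1 - i))"
    have "even r" and "even (r + 1)"
      using *[rule_format, THEN evn, of "k - 1"] *[rule_format, THEN evn, of "k - 2"] assms(3)
      by (auto simp: Suc_diff_Suc numeral_2_eq_2)
    then show thesis by simp
  qed
qed

text \<open>
  The cells below a line of P2 in an even row above row 0 form a line of P1.  P2's last move did not
  add a piece of P1, so that line was there before and the game had already ended.
\<close>

lemma P2_never_connects:
  assumes "odd h" and "even w" and "k \<ge> 2" and \<sigma>: "nonlosing_row_strategy w k P2 \<sigma>"
    and play: "play w h k ms" and foll: "follows P2 (delayed_take_even \<sigma>) ms"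
  shows "\<not> connects k (board_of ms) P2"
proof -
  have after_round: "\<not> connects k (board_of ms) P2"
    if ms: "play w h k ms" "follows P2 (delayed_take_even \<sigma>) ms" "even (length ms)" for ms
  proof
    assume "connects k (board_of ms) P2"
    have inv: "invariant w k \<sigma> ms"
      using assms(1,2) \<sigma> ms by (rule invariant_holds)
    then have settled: "settled (board_of ms)" by (simp add: invariant_def)
    obtain c r where r: "even r" and line: "\<forall>i<k. occupies (board_of ms) P2 (c + i) r"
      using settled \<open>connects k (board_of ms) P2\<close> \<open>k \<ge> 2\<close> by (rule settled_connects_P2)
    show False
    proof (cases "r = 0")
      case True
      then have "\<forall>i<k. occupies (board_of (row0_moves ms)) P2 (c + i) 0"
        using line inv by (auto simp: invariant_def row0_synced_def occupies_def)
      then have "connects k (board_of (row0_moves ms)) P2"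
        unfolding connects_def by blast
      then show False
        using \<sigma> inv by (auto simp: nonlosing_row_strategy_def invariant_def)
    next
      case False
      have "occupies (board_of ms) P1 (c + i) (r - 1)" if "i < k" for i
      proof -
        have "occupies (board_of ms) (board_of ms (c + i) ! (r - 1)) (c + i) (r - 1)"
          using line that False by (auto simp: occupies_def)
        moreover from settledD(2)[OF settled this]
        have "board_of ms (c + i) ! (r - 1) = P1" using r False by auto
        ultimately show ?thesis by simp
      qed
      then have "connects k (board_of ms) P1"
        unfolding connects_def by blast
      moreover obtain e ms' where [simp]: "ms = e # ms'"
        using line[rule_format, of 0] \<open>k \<ge> 2\<close> by (cases ms) (auto simp: occupies_def)
      ultimately have "connects k (board_of ms') P1"
        using ms(3) connects_by_opponent_move[of k e ms' P1] by simp
      then show False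
        using play_ConsD(2)[of w h k e ms'] ms(1) by (simp add: game_over_def)
    qed
  qed
  show ?thesis
  proof (cases "even (length ms)")
    case True
    then show ?thesis using play foll after_round by blast
  next
    case False
    then obtain d ms' where [simp]: "ms = d # ms'" by (cases ms) auto
    have "\<not> connects k (board_of ms') P2"
      using play foll False play_ConsD(1) by (intro after_round) auto
    then show ?thesis
      using False connects_by_opponent_move[of k d ms' P2] by auto
  qed
qed

text \<open>
  Since \<open>w * h\<close> is even, the board fills up at the end of a round, and then row 1 belongs to P1.
\<close>

lemma P1_connects_at_end:
  assumes "odd h" and "h \<ge> 3" and "even w" and "w \<ge> k" and "k \<ge> 2"
    and \<sigma>: "nonlosing_row_strategy w k P2 \<sigma>"
    and play: "play w h k ms" and foll: "follows P2 (delayed_take_even \<sigma>) ms"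
    and over: "game_over w h k ms"
  shows "connects k (board_of ms) P1"
proof -
  have "connects k (board_of ms) P1" if full: "board_full w h ms"
  proof -
    have "even (length ms)"
      using play_length_full[OF play full] \<open>even w\<close> by simp
    then have settled: "settled (board_of ms)"
      using invariant_holds[OF \<open>odd h\<close> \<open>even w\<close> \<sigma> play foll] by (simp add: invariant_def)
    have "occupies (board_of ms) P1 (0 + i) 1" if "i < k" for i
    proof -
      have "occupies (board_of ms) (board_of ms i ! 1) i 1"
        using full that \<open>w \<ge> k\<close> \<open>h \<ge> 3\<close> by (simp add: occupies_def board_full_def)
      with settledD(2)[OF settled this] show ?thesis by simp
    qed
    then show ?thesis unfolding connects_def by blast
  qed
  then show ?thesis
    using over P2_never_connects[OF assms(1,3,5) \<sigma> play foll] by (auto simp: game_over_def)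
qed

lemma delayed_take_even_winning:
  assumes "odd h" and "h \<ge> 3" and "even w" and "w \<ge> k" and "k \<ge> 2"
    and \<sigma>: "nonlosing_row_strategy w k P2 \<sigma>"
  shows "winning_strategy w h k P2 (delayed_take_even \<sigma>)"
proof (rule winning_strategyI)
  show "legal_strategy w h k P2 (delayed_take_even \<sigma>)"
    unfolding legal_strategy_def
  proof (intro allI impI; elim conjE)
    fix ms
    assume ms: "play w h k ms" "follows P2 (delayed_take_even \<sigma>) ms"
      "\<not> game_over w h k ms" "mover ms = P2"
    then obtain d ms' where "ms = d # ms'" by (cases ms) auto
    then show "legal_move w h ms (delayed_take_even \<sigma> ms)"
      using delayed_take_even_answer(1)[OF assms(1,3) \<sigma>] ms by blast
  qed
next
  fix ms
  assume "play w h k ms" "follows P2 (delayed_take_even \<sigma>) ms" "game_over w h k ms"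
  then show "wins k P2 ms"
    using P1_connects_at_end[OF assms] P2_never_connects[OF assms(1,3,5) \<sigma>]
    by (simp add: wins_def)
qed

theorem theorem2:
  fixes w h k :: nat
  assumes "odd h" and "h \<ge> 3" and "even w" and "w \<ge> k" and "k \<ge> 3"
  shows
    "(\<exists>\<sigma>. nonlosing_row_strategy w k P2 \<sigma>) \<and>
     (\<forall>\<sigma>. nonlosing_row_strategy w k P2 \<sigma> \<longrightarrow>
        (\<forall>d ms. play w h k (d # ms) \<and> follows P2 (delayed_take_even \<sigma>) (d # ms) \<and>
              \<not> game_over w h k (d # ms) \<and> mover (d # ms) = P2 \<longrightarrow>
           (let c = delayed_take_even \<sigma> (d # ms) in
              legal_move w h (d # ms) c \<and>
              (if landing_row ms d = 0 then landing_row (d # ms) c = 0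
               else c = d \<and> landing_row (d # ms) c = landing_row ms d + 1))) \<and>
        (\<forall>ms. play w h k ms \<and> follows P2 (delayed_take_even \<sigma>) ms \<and> game_over w h k ms \<longrightarrow>
           connects k (board_of ms) P1 \<and> \<not> connects k (board_of ms) P2) \<and>
        winning_strategy w h k P2 (delayed_take_even \<sigma>)) \<and>
     (\<exists>\<tau>. winning_strategy w h k P2 \<tau>)"
proof (intro conjI)
  have k: "k \<ge> 2" using assms(5) by simp
  show row_strategy: "\<exists>\<sigma>. nonlosing_row_strategy w k P2 \<sigma>"
    using pairing_strategy_nonlosing[OF assms(3,5)] by blast
  then show "\<exists>\<tau>. winning_strategy w h k P2 \<tau>"
    using delayed_take_even_winning[OF assms(1-4) k] by blast
  show "\<forall>\<sigma>. nonlosing_row_strategy w k P2 \<sigma> \<longrightarrow>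
        (\<forall>d ms. play w h k (d # ms) \<and> follows P2 (delayed_take_even \<sigma>) (d # ms) \<and>
              \<not> game_over w h k (d # ms) \<and> mover (d # ms) = P2 \<longrightarrow>
           (let c = delayed_take_even \<sigma> (d # ms) in
              legal_move w h (d # ms) c \<and>
              (if landing_row ms d = 0 then landing_row (d # ms) c = 0
               else c = d \<and> landing_row (d # ms) c = landing_row ms d + 1))) \<and>
        (\<forall>ms. play w h k ms \<and> follows P2 (delayed_take_even \<sigma>) ms \<and> game_over w h k ms \<longrightarrow>
           connects k (board_of ms) P1 \<and> \<not> connects k (board_of ms) P2) \<and>
        winning_strategy w h k P2 (delayed_take_even \<sigma>)"
    unfolding Let_def
    using delayed_take_even_answer[OF assms(1,3)] P1_connects_at_end[OF assms(1-4) k]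
      P2_never_connects[OF assms(1,3) k] delayed_take_even_winning[OF assms(1-4) k]
    by blast
qed

end
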